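(* Let $n\ge 2$. Every element $A=(a;a_\mu)\in\mathfrak{J}_{1,n-1}$ of a given rank is $\mathrm{SO}(1,1)\times\mathrm{SO}(1,n-1)$-related (i.e. lies in the same orbit under the action given in the context) to one of the following canonical forms: 1. Rank 1: (a) $A_{1a}=(1;0)=E_1$; (b) $A_{1b}=(-1;0)=-E_1$; (c) $A_{1c}=(0;\tfrac12,\tfrac12)=E_2$. 2. Rank 2: (a) $A_{2a}=(0;1,0)=E_2+E_3$; (b) $A_{2b}=(0;0,1)=E_2-E_3$; (c) $A_{2c}=(1;\tfrac12,\tfrac12)=E_1+E_2$; (d) $A_{2d}=(-1;\tfrac12,\tfrac12)=-E_1+E_2$. 3. Rank 3: (a) $A_{3a}=(1;\tfrac12(1+k),\tfrac12(1-k))=E_1+E_2+kE_3$; (b) $A_{3b}=(-1;\tfrac12(1+k),\tfrac12(1-k))=-E_1+E_2+kE_3$, for some real $k\neq 0$. Moreover, if one restricts $\mathrm{SO}(1,n-1)$ to its identity-connected component, then each of the orbits of $A_{1c}$, $A_{2c}$ and $A_{2d}$ splits into two cases, $A^{\pm}_{1c}$, $A^{\pm}_{2c}$, $A^{\pm}_{2d}$, corresponding to $a_\mu$ lying on the future or past light cone; similarly the orbit of $A_{2a}$ splits into two disconnected components $A^{\pm}_{2a}$, corresponding to the future and past hyperboloids; and for $k>0$ the orbits of $A_{3a}$ and $A_{3b}$ also split into disconnected future and past hyperboloids, $A^{\pm}_{3a}$ and $A^{\pm}_{3b}$.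
   Context: The Lorentzian spin factor cubic Jordan algebra is $\mathfrak{J}_{1,n-1}=\mathbb{R}\oplus\Gamma_{1,n-1}$, whose underlying vector space is $\mathbb{R}\oplus\mathbb{R}^{1,n-1}$. Elements are written $A=(a;a_\mu)=(a;a_0,a_i)$ with $a\in\mathbb{R}$, $a_\mu\in\mathbb{R}^{1,n-1}$, $i=1,\dots,n-1$. Indices are raised with $\eta=\mathrm{diag}(1,-1,\dots,-1)$, so $a_\mu a^\mu=a_0^2-\sum_i a_i^2$. The notation $(a;a_0,a_1)$ means that $a_i=0$ for all $i>1$, and $(a;0)$ means $a_\mu=0$. The cubic norm is $N(A)=a\,a_\mu a^\mu$, and the quadratic adjoint is $A^\sharp=(a_\mu a^\mu;\,a\,a^\mu)$. The rank of a non-zero $A$ is: rank 1 iff $A^\sharp=0$; rank 2 iff $N(A)=0$ and $A^\sharp\ne0$; rank 3 iff $N(A)\neq0$. Put $E_1=(1;0)$, $E_2=(0;\tfrac12,\tfrac12)$, $E_3=(0;\tfrac12,-\tfrac12)$. The group $\mathrm{SO}(1,1)\times\mathrm{SO}(1,n-1)$ (norm-preserving, restricted to determinant 1 matrices) acts by $$(a;a_\mu)\mapsto(e^{2\lambda}a;\;e^{-\lambda}\Lambda_\mu{}^\nu a_\nu),\qquad \lambda\in\mathbb{R},\ \Lambda\in\mathrm{SO}(1,n-1).$$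
   Formalization: For n = 2 the claim as printed fails (E_3 has rank 1 but lies in none of the listed orbits), so for n = 2 only, the rank 1 list also allows E_3, and the rank 2 list also allows E_1+E_3 and -E_1+E_3. *)

theory Defs
  imports "HOL-Analysis.Analysis"
begin

text \<open>
  Elements \<open>(a; a\<^sub>\<mu>)\<close> of the Jordan algebra are pairs \<open>(a, v)\<close> of type \<open>real \<times> (real ^ 'n)\<close>
  with \<open>n = CARD('n)\<close>.  Two distinct indices \<open>t x :: 'n\<close> play the roles of the time index \<open>0\<close>
  and of the first space index \<open>1\<close>; the remaining elements of \<open>'n\<close> are the other space indices.
\<close>

definition eta :: "'n::finite \<Rightarrow> real ^ 'n ^ 'n" where
  "eta t = (\<chi> i j. if i = j then (if i = t then 1 else - 1) else 0)"

text \<open>\<open>a\<^sup>\<mu>\<close>, and \<open>a\<^sub>\<mu> a\<^sup>\<mu>\<close>.\<close>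

definition raise :: "'n::finite \<Rightarrow> real ^ 'n \<Rightarrow> real ^ 'n" where
  "raise t v = eta t *v v"

definition mink_sq :: "'n::finite \<Rightarrow> real ^ 'n \<Rightarrow> real" where
  "mink_sq t v = v \<bullet> raise t v"

lemma mink_sq_eq: "mink_sq t v = (v $ t)\<^sup>2 - (\<Sum>i\<in>UNIV - {t}. (v $ i)\<^sup>2)"
proof -
  have "raise t v $ i = (if i = t then v $ i else - (v $ i))" for i
    by (simp add: raise_def eta_def matrix_vector_mult_def if_distrib [of "\<lambda>c. c * _"]
        cong: if_cong)
  then have "mink_sq t v = (\<Sum>i\<in>UNIV. if i = t then (v $ i)\<^sup>2 else - (v $ i)\<^sup>2)"
    by (auto simp: mink_sq_def inner_vec_def power2_eq_square intro!: sum.cong)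
  also have "\<dots> = (v $ t)\<^sup>2 + (\<Sum>i\<in>UNIV - {t}. if i = t then (v $ i)\<^sup>2 else - (v $ i)\<^sup>2)"
    by (subst sum.remove [of _ t]) auto
  also have "(\<Sum>i\<in>UNIV - {t}. if i = t then (v $ i)\<^sup>2 else - (v $ i)\<^sup>2)
      = - (\<Sum>i\<in>UNIV - {t}. (v $ i)\<^sup>2)"
    unfolding sum_negf [symmetric] by (rule sum.cong) auto
  finally show ?thesis by simp
qed

definition cubic_norm :: "'n::finite \<Rightarrow> real \<times> (real ^ 'n) \<Rightarrow> real" where
  "cubic_norm t A = fst A * mink_sq t (snd A)"

definition adjoint_sharp :: "'n::finite \<Rightarrow> real \<times> (real ^ 'n) \<Rightarrow> real \<times> (real ^ 'n)" where
  "adjoint_sharp t A = (mink_sq t (snd A), fst A *\<^sub>R raise t (snd A))"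

definition rank1 :: "'n::finite \<Rightarrow> real \<times> (real ^ 'n) \<Rightarrow> bool" where
  "rank1 t A \<longleftrightarrow> A \<noteq> 0 \<and> adjoint_sharp t A = 0"

definition rank2 :: "'n::finite \<Rightarrow> real \<times> (real ^ 'n) \<Rightarrow> bool" where
  "rank2 t A \<longleftrightarrow> A \<noteq> 0 \<and> cubic_norm t A = 0 \<and> adjoint_sharp t A \<noteq> 0"

definition rank3 :: "'n::finite \<Rightarrow> real \<times> (real ^ 'n) \<Rightarrow> bool" where
  "rank3 t A \<longleftrightarrow> A \<noteq> 0 \<and> cubic_norm t A \<noteq> 0"

text \<open>\<open>SO(1,n-1)\<close>, and its identity-connected component as a subspace of the space of matrices.\<close>

definition SO_lorentz :: "'n::finite \<Rightarrow> (real ^ 'n ^ 'n) set" where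
  "SO_lorentz t = {L. transpose L ** eta t ** L = eta t \<and> det L = 1}"

definition SO0_lorentz :: "'n::finite \<Rightarrow> (real ^ 'n ^ 'n) set" where
  "SO0_lorentz t = connected_component_set (SO_lorentz t) (mat 1)"

definition act :: "real \<Rightarrow> real ^ 'n ^ 'n \<Rightarrow> real \<times> (real ^ 'n) \<Rightarrow> real \<times> (real ^ 'n::finite)" where
  "act l L A = (exp (2 * l) * fst A, exp (- l) *\<^sub>R (L *v snd A))"

text \<open>The orbit of \<open>A\<close> under \<open>SO(1,1) \<times> H\<close>, where \<open>SO(1,1)\<close> is parametrised by
  \<open>l :: real\<close>.\<close>

definition orbit ::
    "(real ^ 'n ^ 'n) set \<Rightarrow> real \<times> (real ^ 'n) \<Rightarrow> (real \<times> (real ^ 'n::finite)) set" where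
  "orbit H A = {act l L A | l L. L \<in> H}"

text \<open>The element \<open>(a; a\<^sub>0, a\<^sub>1)\<close>, all other components being zero.\<close>

definition elt :: "'n \<Rightarrow> 'n \<Rightarrow> real \<Rightarrow> real \<Rightarrow> real \<Rightarrow> real \<times> (real ^ 'n::finite)" where
  "elt t x a a0 a1 = (a, \<chi> i. if i = t then a0 else if i = x then a1 else 0)"

definition E1 :: "real \<times> (real ^ 'n::finite)" where
  "E1 = (1, 0)"

definition E2 :: "'n \<Rightarrow> 'n \<Rightarrow> real \<times> (real ^ 'n::finite)" where
  "E2 t x = elt t x 0 (1/2) (1/2)"

definition E3 :: "'n \<Rightarrow> 'n \<Rightarrow> real \<times> (real ^ 'n::finite)" where
  "E3 t x = elt t x 0 (1/2) (- 1/2)"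

definition A1a :: "real \<times> (real ^ 'n::finite)" where
  "A1a = (1, 0)"

definition A1b :: "real \<times> (real ^ 'n::finite)" where
  "A1b = (- 1, 0)"

definition A1c :: "'n \<Rightarrow> 'n \<Rightarrow> real \<times> (real ^ 'n::finite)" where
  "A1c t x = elt t x 0 (1/2) (1/2)"

definition A2a :: "'n \<Rightarrow> 'n \<Rightarrow> real \<times> (real ^ 'n::finite)" where
  "A2a t x = elt t x 0 1 0"

definition A2b :: "'n \<Rightarrow> 'n \<Rightarrow> real \<times> (real ^ 'n::finite)" where
  "A2b t x = elt t x 0 0 1"

definition A2c :: "'n \<Rightarrow> 'n \<Rightarrow> real \<times> (real ^ 'n::finite)" where
  "A2c t x = elt t x 1 (1/2) (1/2)"

definition A2d :: "'n \<Rightarrow> 'n \<Rightarrow> real \<times> (real ^ 'n::finite)" where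
  "A2d t x = elt t x (- 1) (1/2) (1/2)"

definition A3a :: "'n \<Rightarrow> 'n \<Rightarrow> real \<Rightarrow> real \<times> (real ^ 'n::finite)" where
  "A3a t x k = elt t x 1 ((1 + k) / 2) ((1 - k) / 2)"

definition A3b :: "'n \<Rightarrow> 'n \<Rightarrow> real \<Rightarrow> real \<times> (real ^ 'n::finite)" where
  "A3b t x k = elt t x (- 1) ((1 + k) / 2) ((1 - k) / 2)"

text \<open>The elements \<open>(a; a\<^sub>\<mu>)\<close> with \<open>a\<^sub>\<mu>\<close> on the future (past) light cone, apex excluded.\<close>

definition future_cone :: "'n::finite \<Rightarrow> (real \<times> (real ^ 'n)) set" where
  "future_cone t = {A. mink_sq t (snd A) = 0 \<and> snd A $ t > 0}"

definition past_cone :: "'n::finite \<Rightarrow> (real \<times> (real ^ 'n)) set" where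
  "past_cone t = {A. mink_sq t (snd A) = 0 \<and> snd A $ t < 0}"

text \<open>The elements \<open>(a; a\<^sub>\<mu>)\<close> with \<open>a\<^sub>\<mu>\<close> on the future (past) sheet of a hyperboloid
  \<open>a\<^sub>\<mu> a\<^sup>\<mu> = r\<close> for some \<open>r > 0\<close>.  The value of \<open>r\<close> cannot be fixed, since the factor
  \<open>SO(1,1)\<close> rescales it within an orbit.\<close>

definition future_hyperboloids :: "'n::finite \<Rightarrow> (real \<times> (real ^ 'n)) set" where
  "future_hyperboloids t = {A. \<exists>r>0. mink_sq t (snd A) = r \<and> snd A $ t > 0}"

definition past_hyperboloids :: "'n::finite \<Rightarrow> (real \<times> (real ^ 'n)) set" where
  "past_hyperboloids t = {A. \<exists>r>0. mink_sq t (snd A) = r \<and> snd A $ t < 0}"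

text \<open>On restricting \<open>SO(1,n-1)\<close> to its identity component, the orbit of \<open>C\<close> decomposes into
  exactly two orbits, namely its parts in \<open>F\<close> and in \<open>P\<close>.\<close>

definition splits_into ::
    "'n \<Rightarrow> real \<times> (real ^ 'n) \<Rightarrow> (real \<times> (real ^ 'n)) set \<Rightarrow> (real \<times> (real ^ 'n::finite)) set \<Rightarrow> bool"
  where
  "splits_into t C F P \<longleftrightarrow>
     orbit (SO0_lorentz t) ` orbit (SO_lorentz t) C
       = {orbit (SO_lorentz t) C \<inter> F, orbit (SO_lorentz t) C \<inter> P} \<and>
     orbit (SO_lorentz t) C \<inter> F \<noteq> orbit (SO_lorentz t) C \<inter> P"

text \<open>The same, where moreover the two parts are the topological connected components of the
  orbit of \<open>C\<close>.\<close>

definition splits_into_components ::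
    "'n \<Rightarrow> real \<times> (real ^ 'n) \<Rightarrow> (real \<times> (real ^ 'n)) set \<Rightarrow> (real \<times> (real ^ 'n::finite)) set \<Rightarrow> bool"
  where
  "splits_into_components t C F P \<longleftrightarrow>
     splits_into t C F P \<and>
     components (orbit (SO_lorentz t) C)
       = {orbit (SO_lorentz t) C \<inter> F, orbit (SO_lorentz t) C \<inter> P}"

end

theory Submission
  imports Defs
begin

text \<open>
  The whole argument is carried by reflections
  \<open>R\<^sub>p v = v - 2 \<langle>p, v\<rangle> / \<langle>p, p\<rangle> p\<close> of Minkowski space along non-null vectors \<open>p\<close>.
  If \<open>\<langle>u, u\<rangle> = \<langle>w, w\<rangle>\<close>, then \<open>u + w\<close> and \<open>u - w\<close> are orthogonal, so that \<open>R\<^sub>u\<^sub>-\<^sub>w\<close> sends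
  \<open>w\<close> to \<open>u\<close> and \<open>R\<^sub>u\<^sub>+\<^sub>w\<close> sends \<open>w\<close> to \<open>- u\<close>, whenever these are defined.  A reflection has
  determinant \<open>- 1\<close> (\<open>det_reflection\<close>), so a product of two of them lies in \<open>SO(1,n-1)\<close>.

  Canonical forms.  For \<open>\<langle>u, u\<rangle> = \<langle>w, w\<rangle> \<noteq> 0\<close> one of \<open>u + w\<close>, \<open>u - w\<close> is not null, and for
  \<open>w = (a, b)\<close> in the plane of the indices \<open>t\<close>, \<open>x\<close> the determinant and sign can be corrected by
  the reflection along \<open>(b, a)\<close>, which fixes \<open>w\<close>, and by an element of \<open>SO(1,n-1)\<close> that is
  \<open>- 1\<close> on that plane (\<open>nonnull_transitive\<close>).  Two future null vectors \<open>u\<close>, \<open>w\<close> are related by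
  \<open>R\<^sub>w\<^sub>+\<^sub>z R\<^sub>z\<^sub>+\<^sub>u\<close>, through any future null \<open>z\<close> that is parallel to neither
  (\<open>null_transitive\<close>).  Such a \<open>z\<close> always exists for \<open>n > 2\<close>; for \<open>n = 2\<close> it exists just when
  \<open>u\<close> and \<open>w\<close> lie on the same null line, and each of the two null lines has a form of its own
  there.  The factor \<open>SO(1,1)\<close> serves to normalise \<open>a \<noteq> 0\<close> to \<open>1\<close> or \<open>- 1\<close>, or, when \<open>a = 0\<close> and
  \<open>a\<^sub>\<mu>\<close> is not null, to normalise \<open>a\<^sub>\<mu> a\<^sup>\<mu>\<close>.

  Splitting.  The future timelike vectors form a convex cone, so for \<open>p\<close>, \<open>q\<close> in it the products
  \<open>R\<^sub>p R\<^sub>q\<close> are connected to \<open>R\<^sub>q R\<^sub>q = 1\<close> and lie in the identity component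
  (\<open>reflection_pair_SO0\<close>).  The product \<open>R\<^sub>w\<^sub>+\<^sub>u R\<^sub>u\<close>, which takes \<open>u\<close> to \<open>w\<close> for future timelike
  vectors of the same square, and the product \<open>R\<^sub>w\<^sub>+\<^sub>z R\<^sub>z\<^sub>+\<^sub>u\<close> for null vectors are of this kind; so
  \<open>SO(1,1)\<close> and the identity component act transitively on the future half of each orbit in
  question.  Conversely both preserve that half: the image of a nonzero causal vector under a
  Lorentz matrix has a nonzero time component, whose sign is constant on a connected set of
  Lorentz matrices (\<open>SO0_preserves_future\<close>).  The map
  \<open>(a; a\<^sub>\<mu>) \<mapsto> (a; - a\<^sub>\<mu>)\<close> commutes with the action and exchanges the two halves, which gives the
  past half (\<open>orbit_splitting\<close>).  Each half is the continuous image of \<open>\<real> \<times> SO\<^sub>0(1,n-1)\<close> and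
  therefore connected, and the sign of the time component separates the two.
\<close>

section \<open>The Minkowski inner product\<close>

definition mink :: "'n::finite \<Rightarrow> real ^ 'n \<Rightarrow> real ^ 'n \<Rightarrow> real" where
  "mink t u v = u \<bullet> raise t v"

lemma raise_nth: "raise t v $ i = (if i = t then v $ i else - (v $ i))"
  by (simp add: raise_def eta_def matrix_vector_mult_def if_distrib [of "\<lambda>c. c * _"] cong: if_cong)

lemma mink_expand: "mink t u v = u $ t * v $ t - (\<Sum>i\<in>UNIV - {t}. u $ i * v $ i)"
proof -
  have "mink t u v = (\<Sum>i\<in>UNIV. u $ i * raise t v $ i)"
    by (simp add: mink_def inner_vec_def)
  also have "\<dots> = u $ t * v $ t + (\<Sum>i\<in>UNIV - {t}. u $ i * raise t v $ i)"
    by (subst sum.remove [of _ t]) (auto simp: raise_nth)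
  also have "(\<Sum>i\<in>UNIV - {t}. u $ i * raise t v $ i) = - (\<Sum>i\<in>UNIV - {t}. u $ i * v $ i)"
    unfolding sum_negf [symmetric] by (rule sum.cong) (auto simp: raise_nth)
  finally show ?thesis by simp
qed

lemma mink_sq_mink: "mink_sq t v = mink t v v"
  by (simp add: mink_def mink_sq_def)

lemma mink_commute: "mink t u v = mink t v u"
  by (simp add: mink_expand mult.commute)

lemma mink_linear [simp]:
  "mink t (u + v) w = mink t u w + mink t v w" "mink t w (u + v) = mink t w u + mink t w v"
  "mink t (u - v) w = mink t u w - mink t v w" "mink t w (u - v) = mink t w u - mink t w v"
  "mink t (- u) w = - mink t u w" "mink t w (- u) = - mink t w u"
  "mink t (c *\<^sub>R u) w = c * mink t u w" "mink t w (c *\<^sub>R u) = c * mink t w u"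
proof -
  have "raise t (u + v) = raise t u + raise t v" "raise t (u - v) = raise t u - raise t v"
    "raise t (- u) = - raise t u" "raise t (c *\<^sub>R u) = c *\<^sub>R raise t u"
    by (simp_all add: vec_eq_iff raise_nth)
  then show "mink t (u + v) w = mink t u w + mink t v w" "mink t w (u + v) = mink t w u + mink t w v"
    "mink t (u - v) w = mink t u w - mink t v w" "mink t w (u - v) = mink t w u - mink t w v"
    "mink t (- u) w = - mink t u w" "mink t w (- u) = - mink t w u"
    "mink t (c *\<^sub>R u) w = c * mink t u w" "mink t w (c *\<^sub>R u) = c * mink t w u"
    by (simp_all add: mink_def inner_simps)
qed

text \<open>
  The vector part of \<open>elt t x c a b\<close>, separated from the scalar part because the Lorentz group
  acts on vectors alone.
\<close>

definition plane :: "'n \<Rightarrow> 'n \<Rightarrow> real \<Rightarrow> real \<Rightarrow> real ^ 'n::finite" where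
  "plane t x a b = (\<chi> i. if i = t then a else if i = x then b else 0)"

lemma elt_plane: "elt t x c a b = (c, plane t x a b)"
  by (simp add: elt_def plane_def)

lemma plane_nth: "plane t x a b $ i = (if i = t then a else if i = x then b else 0)"
  by (simp add: plane_def)

lemma mink_plane:
  assumes "t \<noteq> x"
  shows "mink t (plane t x a b) v = a * v $ t - b * v $ x"
proof -
  have "(\<Sum>i\<in>UNIV - {t}. plane t x a b $ i * v $ i) = (\<Sum>i\<in>UNIV - {t}. if i = x then b * v $ x else 0)"
    by (rule sum.cong) (auto simp: plane_nth)
  also have "\<dots> = b * v $ x"
    using assms by simp
  finally show ?thesis
    by (simp add: mink_expand plane_nth)
qed

section \<open>The Lorentz group and its identity component\<close>

text \<open>
  The full group \<open>O(1,n-1)\<close>, in which single reflections live.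
\<close>

definition O_lorentz :: "'n::finite \<Rightarrow> (real ^ 'n ^ 'n) set" where
  "O_lorentz t = {L. transpose L ** eta t ** L = eta t}"

lemma SO_lorentz_iff: "L \<in> SO_lorentz t \<longleftrightarrow> L \<in> O_lorentz t \<and> det L = 1"
  by (simp add: SO_lorentz_def O_lorentz_def)

lemma mink_matrix: "mink t (L *v u) (L *v v) = u \<bullet> ((transpose L ** eta t ** L) *v v)"
proof -
  have "u \<bullet> (transpose L *v z) = (L *v u) \<bullet> z" for z
    by (metis dot_lmul_matrix inner_commute transpose_matrix_vector)
  then show ?thesis
    by (simp add: mink_def raise_def flip: matrix_vector_mul_assoc)
qed

lemma O_lorentz_iff: "L \<in> O_lorentz t \<longleftrightarrow> (\<forall>u v. mink t (L *v u) (L *v v) = mink t u v)"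
proof -
  have "(\<forall>u v. mink t (L *v u) (L *v v) = mink t u v)
      \<longleftrightarrow> (\<forall>v u. u \<bullet> ((transpose L ** eta t ** L) *v v) = u \<bullet> (eta t *v v))"
    unfolding mink_matrix by (auto simp: mink_def raise_def)
  also have "\<dots> \<longleftrightarrow> (\<forall>v. (transpose L ** eta t ** L) *v v = eta t *v v)"
    by (simp only: vector_eq_ldot)
  also have "\<dots> \<longleftrightarrow> L \<in> O_lorentz t"
    by (simp only: O_lorentz_def mem_Collect_eq matrix_eq)
  finally show ?thesis by blast
qed

lemma det_eta_nonzero: "det (eta t) \<noteq> 0"
proof -
  have "det (eta t) = (\<Prod>i\<in>UNIV. eta t $ i $ i)"
    by (rule det_diagonal) (simp add: eta_def)
  also have "\<dots> \<noteq> 0" by (simp add: eta_def)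
  finally show ?thesis .
qed

lemma det_sq_O_lorentz:
  assumes "L \<in> O_lorentz t"
  shows "det L * det L = 1"
proof -
  have "det (transpose L ** eta t ** L) = det (eta t)"
    using assms by (simp add: O_lorentz_def)
  then show ?thesis
    using det_eta_nonzero [of t] by (simp add: det_mul det_transpose)
qed

lemma O_lorentz_mult: "L \<in> O_lorentz t \<Longrightarrow> M \<in> O_lorentz t \<Longrightarrow> L ** M \<in> O_lorentz t"
  by (simp add: O_lorentz_iff flip: matrix_vector_mul_assoc)

lemma SO_lorentz_mult: "L \<in> SO_lorentz t \<Longrightarrow> M \<in> SO_lorentz t \<Longrightarrow> L ** M \<in> SO_lorentz t"
  by (simp add: SO_lorentz_iff O_lorentz_mult det_mul)

lemma mat_1_SO: "mat 1 \<in> SO_lorentz t"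
  by (simp add: SO_lorentz_iff O_lorentz_iff)

lemma SO_lorentz_inverse:
  assumes "L \<in> SO_lorentz t"
  obtains K where "K \<in> SO_lorentz t" "K ** L = mat 1" "L ** K = mat 1"
proof -
  have "invertible L"
    using assms by (simp add: SO_lorentz_iff invertible_det_nz)
  then obtain K where K: "K ** L = mat 1" "L ** K = mat 1"
    by (auto simp: invertible_def)
  have "mink t (K *v u) (K *v v) = mink t (L *v (K *v u)) (L *v (K *v v))" for u v
    using assms by (simp add: SO_lorentz_iff O_lorentz_iff)
  then have "K \<in> O_lorentz t"
    by (simp add: O_lorentz_iff matrix_vector_mul_assoc K)
  moreover have "det K * det L = 1"
    by (simp add: K flip: det_mul)
  then have "det K = 1" using assms by (simp add: SO_lorentz_iff)
  ultimately show thesis using K that by (simp add: SO_lorentz_iff)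
qed

lemma SO0_subset: "SO0_lorentz t \<subseteq> SO_lorentz t"
  by (simp add: SO0_lorentz_def connected_component_subset)

lemma mat_1_SO0: "mat 1 \<in> SO0_lorentz t"
  by (simp add: SO0_lorentz_def mat_1_SO connected_component_refl_eq)

lemma connected_SO0: "connected (SO0_lorentz t)"
  by (simp add: SO0_lorentz_def)

lemma SO0_maximal: "connected X \<Longrightarrow> X \<subseteq> SO_lorentz t \<Longrightarrow> L \<in> X \<Longrightarrow> L \<in> SO0_lorentz t \<Longrightarrow> X \<subseteq> SO0_lorentz t"
  unfolding SO0_lorentz_def
  by (metis connected_component_eq connected_component_maximal)

lemma connected_translate_SO0: "connected ((**) L ` SO0_lorentz t)"
  by (intro connected_continuous_image connected_SO0)
     (simp add: matrix_matrix_mult_def, intro continuous_intros)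

text \<open>
  For \<open>L\<close> in the identity component, the translate of that component by \<open>L\<close> is a connected set
  containing \<open>L\<close>.
\<close>

lemma SO0_mult: 
  assumes "L \<in> SO0_lorentz t" "M \<in> SO0_lorentz t"
  shows "L ** M \<in> SO0_lorentz t"
proof -
  have "(**) L ` SO0_lorentz t \<subseteq> SO0_lorentz t"
  proof (rule SO0_maximal)
    show "L \<in> (**) L ` SO0_lorentz t"
      using mat_1_SO0 [of t] by (metis image_eqI matrix_mul_rid)
    show "(**) L ` SO0_lorentz t \<subseteq> SO_lorentz t"
      using assms(1) SO0_subset by (auto intro!: SO_lorentz_mult)
  qed (fact assms(1) connected_translate_SO0)+
  with assms show ?thesis by blast
qed

text \<open>
  The translate of the identity component by the inverse \<open>K\<close> of \<open>L\<close> is connected and contains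
  \<open>K ** L = 1\<close>, hence stays in the component.
\<close>

lemma SO0_inverse:
  assumes "L \<in> SO0_lorentz t"
  obtains K where "K \<in> SO0_lorentz t" "K ** L = mat 1"
proof -
  have "L \<in> SO_lorentz t"
    using assms SO0_subset by (rule subsetD [rotated])
  then obtain K where K: "K \<in> SO_lorentz t" "K ** L = mat 1"
    by (rule SO_lorentz_inverse)
  have "(**) K ` SO0_lorentz t \<subseteq> SO0_lorentz t"
  proof (rule SO0_maximal)
    show "mat 1 \<in> (**) K ` SO0_lorentz t"
      using assms K(2) by (intro image_eqI [of _ _ L]) auto
    show "(**) K ` SO0_lorentz t \<subseteq> SO_lorentz t"
      using K(1) SO0_subset by (auto intro!: SO_lorentz_mult)
  qed (fact mat_1_SO0 connected_translate_SO0)+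
  moreover have "K \<in> (**) K ` SO0_lorentz t"
    using mat_1_SO0 by (intro image_eqI [of _ _ "mat 1"]) auto
  ultimately show thesis
    using K(2) by (intro that [of K]) auto
qed

section \<open>Reflections\<close>

definition reflection :: "'n::finite \<Rightarrow> real ^ 'n \<Rightarrow> real ^ 'n ^ 'n" where
  "reflection t p = (\<chi> i j. (if i = j then 1 else 0) - 2 / mink t p p * (p $ i * raise t p $ j))"

lemma reflection_apply: "reflection t p *v v = v - (2 * mink t p v / mink t p p) *\<^sub>R p"
proof -
  have *: "(\<Sum>j\<in>UNIV. (if i = j then v $ j else 0) - c * (v $ j * raise t p $ j)) = v $ i - c * mink t v p" for i c
    by (simp add: sum_subtractf mink_def inner_vec_def sum_distrib_left)
  have "(reflection t p *v v) $ i
      = (\<Sum>j\<in>UNIV. (if i = j then v $ j else 0) - 2 / mink t p p * p $ i * (v $ j * raise t p $ j))" for i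
    unfolding reflection_def matrix_vector_mult_def vec_lambda_beta
    by (rule sum.cong) (auto simp: left_diff_distrib)
  then show ?thesis
    unfolding * by (simp add: vec_eq_iff mink_commute [of t v])
qed

lemma reflection_O:
  assumes "mink t p p \<noteq> 0"
  shows "reflection t p \<in> O_lorentz t"
proof -
  have "mink t (reflection t p *v u) (reflection t p *v v) = mink t u v" for u v
    using assms by (simp add: reflection_apply mink_commute [of t u p] field_simps)
  then show ?thesis by (simp add: O_lorentz_iff)
qed

lemma reflection_fix: "mink t p v = 0 \<Longrightarrow> reflection t p *v v = v"
  by (simp add: reflection_apply)

lemma reflection_diff:
  assumes "mink t u u = mink t w w" "mink t (u - w) (u - w) \<noteq> 0"
  shows "reflection t (u - w) *v w = u"
proof -
  \<comment> \<open>The vector \<open>u - w\<close> is orthogonal to \<open>u + w\<close>, and \<open>u - w = (u + w) - 2 w\<close>.\<close>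
  have "mink t (u - w) (u - w) = - 2 * mink t (u - w) w"
    using assms(1) by (simp add: mink_commute [of t u w])
  then have "2 * mink t (u - w) w / mink t (u - w) (u - w) = -1"
    using assms(2) by (simp only: divide_eq_eq) simp
  then show ?thesis by (simp add: reflection_apply)
qed

lemma reflection_sum:
  assumes "mink t u u = mink t w w" "mink t (u + w) (u + w) \<noteq> 0"
  shows "reflection t (u + w) *v w = - u"
  using reflection_diff [of t "-u" w] assms
  by (simp add: reflection_apply mink_commute [of t u w] algebra_simps)

lemma reflection_scale: "c \<noteq> 0 \<Longrightarrow> reflection t (c *\<^sub>R p) = reflection t p"
  by (simp add: matrix_eq reflection_apply field_simps)

lemma reflection_uminus: "reflection t (- p) = reflection t p"
  by (simp add: matrix_eq reflection_apply)

lemma reflection_involution: "mink t p p \<noteq> 0 \<Longrightarrow> reflection t p *v (reflection t p *v v) = v"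
  by (simp add: reflection_apply field_simps)

lemma reflection_involution_matrix: "mink t p p \<noteq> 0 \<Longrightarrow> reflection t p ** reflection t p = mat 1"
  by (simp add: matrix_eq reflection_involution flip: matrix_vector_mul_assoc)

lemma reflection_conjugate:
  assumes "mink t r r \<noteq> 0"
  shows "reflection t r ** reflection t p ** reflection t r = reflection t (reflection t r *v p)"
proof -
  have inv: "mink t (reflection t r *v u) (reflection t r *v v) = mink t u v" for u v
    using reflection_O [OF assms] by (simp add: O_lorentz_iff)
  have "mink t p (reflection t r *v v) = mink t (reflection t r *v p) v" for v
    using inv [of p "reflection t r *v v"] by (simp add: reflection_involution assms)
  then show ?thesis
    by (simp add: matrix_eq reflection_apply [of t p] reflection_apply [of t "reflection t r *v p"] inv
        matrix_vector_mult_diff_distrib scaleR_matrix_vector_assoc [symmetric] matrix_vector_mult_scaleR reflection_involution assms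
        flip: matrix_vector_mul_assoc)
qed

text \<open>
  If \<open>\<langle>p, p\<rangle> = \<langle>q, q\<rangle>\<close>, a reflection along \<open>q - p\<close> or \<open>q + p\<close> takes \<open>p\<close> to \<open>q\<close> or \<open>- q\<close> and so
  conjugates the two reflections into each other.
\<close>

lemma det_reflection_cong:
  assumes "mink t p p = mink t q q" "mink t q q \<noteq> 0"
  shows "det (reflection t p) = det (reflection t q)"
proof -
  obtain r where r: "mink t r r \<noteq> 0" and eq: "reflection t (reflection t r *v p) = reflection t q"
  proof (cases "mink t (q - p) (q - p) = 0")
    case False
    then show thesis using that [of "q - p"] reflection_diff [of t q p] assms by simp
  next
    case True
    then have "mink t (q + p) (q + p) \<noteq> 0"
      using assms by (simp add: mink_commute [of t p q])
    then show thesis using that [of "q + p"] reflection_sum [of t q p] assms by (simp add: reflection_uminus)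
  qed
  have "det (reflection t q) = det (reflection t r) * det (reflection t r) * det (reflection t p)"
    by (simp add: det_mul flip: eq reflection_conjugate [OF r])
  then show ?thesis
    by (simp add: det_sq_O_lorentz [OF reflection_O [OF r]])
qed

lemma mink_axis: "mink t (axis i 1) (axis i 1) = (if i = t then 1 else - 1)"
  unfolding mink_def inner_axis' by (simp add: raise_nth axis_def)

lemma det_reflection_axis: "det (reflection t (axis i 1)) = - 1"
proof -
  have "det (reflection t (axis i 1)) = (\<Prod>j\<in>UNIV. reflection t (axis i 1) $ j $ j)"
    by (rule det_diagonal) (auto simp: reflection_def axis_def raise_nth)
  also have "\<dots> = (\<Prod>j\<in>UNIV. if j = i then - 1 else 1)"
    unfolding reflection_def mink_axis by (rule prod.cong) (auto simp: axis_def raise_nth)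
  finally show ?thesis by simp
qed

text \<open>
  By rescaling and \<open>det_reflection_cong\<close> it is enough to look at the reflections along the
  coordinate axes, which are diagonal: the time axis when \<open>p\<close> is timelike, a space axis
  otherwise.
\<close>

lemma det_reflection:
  fixes t :: "'n::finite"
  assumes "CARD('n) \<ge> 2" "mink t p p \<noteq> 0"
  shows "det (reflection t p) = - 1"
proof -
  obtain x where x: "x \<noteq> t"
    using assms(1) by (metis card_le_Suc0_iff_eq finite numeral_2_eq_2 not_less_eq_eq)
  define i where "i = (if mink t p p > 0 then t else x)"
  define e where "e = (axis i 1 :: real ^ 'n)"
  have m: "mink t e e = sgn (mink t p p)"
    using assms(2) x by (auto simp: e_def i_def mink_axis sgn_if)
  let ?c = "sqrt \<bar>mink t p p\<bar>"
  have "mink t (?c *\<^sub>R e) (?c *\<^sub>R e) = mink t p p"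
    using real_sqrt_mult_self [of "mink t p p"] by (simp add: m abs_mult_sgn flip: mult.assoc)
  then have "det (reflection t p) = det (reflection t (?c *\<^sub>R e))"
    using assms(2) by (intro det_reflection_cong) auto
  also have "\<dots> = - 1"
    using assms(2) by (simp add: reflection_scale e_def det_reflection_axis)
  finally show ?thesis .
qed

lemma reflection_pair_SO:
  fixes t :: "'n::finite"
  assumes "CARD('n) \<ge> 2" "mink t p p \<noteq> 0" "mink t q q \<noteq> 0"
  shows "reflection t p ** reflection t q \<in> SO_lorentz t"
  using assms by (simp add: SO_lorentz_iff O_lorentz_mult reflection_O det_mul det_reflection)


section \<open>Future timelike vectors\<close>

definition future_timelike :: "'n::finite \<Rightarrow> (real ^ 'n) set" where
  "future_timelike t = {p. mink t p p > 0 \<and> p $ t > 0}"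

text \<open>
  A weak form of the reversed Cauchy-Schwarz inequality: the ordinary one bounds the spatial part
  of the product by the time part.
\<close>

lemma mink_future_pos:
  assumes "q \<in> future_timelike t" "mink t u u \<ge> 0" "u $ t > 0"
  shows "mink t u q > 0"
proof -
  let ?S = "\<lambda>v w. \<Sum>i\<in>UNIV - {t}. v $ i * w $ i"
  have "(?S u q)\<^sup>2 \<le> (\<Sum>i\<in>UNIV - {t}. (u $ i)\<^sup>2) * (\<Sum>i\<in>UNIV - {t}. (q $ i)\<^sup>2)"
    by (rule Cauchy_Schwarz_ineq_sum)
  also have "\<dots> = ?S u u * ?S q q"
    by (simp add: power2_eq_square)
  also have "\<dots> \<le> (u $ t * u $ t) * ?S q q"
    using assms(2) by (intro mult_right_mono sum_nonneg) (auto simp: mink_expand)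
  also have "\<dots> < (u $ t * u $ t) * (q $ t * q $ t)"
    using assms(1,3) by (intro mult_strict_left_mono) (auto simp: mink_expand future_timelike_def)
  finally have "(?S u q)\<^sup>2 < (u $ t * q $ t)\<^sup>2"
    by (simp add: power2_eq_square mult_ac)
  then have "?S u q < u $ t * q $ t"
    by (rule power2_less_imp_less) (use assms in \<open>simp add: future_timelike_def\<close>)
  then show ?thesis by (simp add: mink_expand)
qed

lemma future_timelike_add: "p \<in> future_timelike t \<Longrightarrow> q \<in> future_timelike t \<Longrightarrow> p + q \<in> future_timelike t"
  using mink_future_pos [of q t p]
  by (auto simp: future_timelike_def mink_commute [of t q p])

lemma future_timelike_scale: "p \<in> future_timelike t \<Longrightarrow> c > 0 \<Longrightarrow> c *\<^sub>R p \<in> future_timelike t"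
  by (simp add: future_timelike_def)

lemma connected_future_timelike: "connected (future_timelike t)"
proof -
  have "convex (future_timelike t)"
    unfolding convex_alt
  proof (intro ballI allI impI)
    fix p q and s :: real
    assume "p \<in> future_timelike t" "q \<in> future_timelike t" "0 \<le> s \<and> s \<le> 1"
    then show "(1 - s) *\<^sub>R p + s *\<^sub>R q \<in> future_timelike t"
      by (cases "s = 0"; cases "s = 1") (auto intro!: future_timelike_add future_timelike_scale)
  qed
  then show ?thesis by (rule convex_connected)
qed

text \<open>
  With \<open>q\<close> fixed, \<open>p \<mapsto> R\<^sub>p R\<^sub>q\<close> is continuous on the convex cone of future timelike vectors and
  passes through the identity matrix at \<open>p = q\<close>.
\<close>

lemma reflection_pair_SO0:
  fixes t :: "'n::finite"
  assumes "CARD('n) \<ge> 2" "p \<in> future_timelike t" "q \<in> future_timelike t"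
  shows "reflection t p ** reflection t q \<in> SO0_lorentz t"
proof -
  let ?f = "\<lambda>p. reflection t p ** reflection t q"
  have ne: "r \<in> future_timelike t \<Longrightarrow> mink t r r \<noteq> 0" for r
    by (auto simp: future_timelike_def)
  have raise: "continuous_on X (raise t)" for X
    unfolding raise_def by (simp add: matrix_vector_mult_def, intro continuous_intros)
  have "continuous_on X (\<lambda>r. mink t r r)" for X
    unfolding mink_def by (intro continuous_intros raise)
  then have "continuous_on (future_timelike t) (reflection t)"
    unfolding reflection_def
    by (intro continuous_intros continuous_on_vec_lambda raise) (use ne in auto)
  then have "continuous_on (future_timelike t) ?f"
    unfolding matrix_matrix_mult_def
    by (intro continuous_intros continuous_on_vec_lambda)
  then have "connected (?f ` future_timelike t)"
    by (rule connected_continuous_image) (rule connected_future_timelike)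
  moreover have "?f ` future_timelike t \<subseteq> SO_lorentz t"
    using assms ne by (auto intro!: reflection_pair_SO)
  moreover have "mat 1 \<in> ?f ` future_timelike t"
    using assms(3) reflection_involution_matrix [OF ne [OF assms(3)]] by force
  ultimately have "?f ` future_timelike t \<subseteq> SO0_lorentz t"
    using mat_1_SO0 by (rule SO0_maximal)
  with assms(2) show ?thesis by blast
qed

text \<open>
  The matrix \<open>R\<^sub>w\<^sub>+\<^sub>u R\<^sub>u\<close> takes \<open>u\<close> to \<open>- u\<close> and then to \<open>w\<close>.
\<close>

lemma timelike_transitive:
  fixes t :: "'n::finite"
  assumes "CARD('n) \<ge> 2" "u \<in> future_timelike t" "w \<in> future_timelike t" "mink t u u = mink t w w"
  shows "\<exists>L\<in>SO0_lorentz t. L *v u = w"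
proof
  have wu: "w + u \<in> future_timelike t"
    using assms by (intro future_timelike_add)
  show "reflection t (w + u) ** reflection t u \<in> SO0_lorentz t"
    using assms wu by (intro reflection_pair_SO0)
  have "reflection t u *v u = - u"
    using assms(2) by (simp add: reflection_apply future_timelike_def scaleR_2)
  moreover have "reflection t (w + u) *v u = - w"
    using wu assms by (intro reflection_sum) (auto simp: future_timelike_def)
  ultimately show "(reflection t (w + u) ** reflection t u) *v u = w"
    by (simp flip: matrix_vector_mul_assoc add: vec.neg)
qed

text \<open>
  There is no reflection along the null vector \<open>u\<close> itself; the detour over \<open>z\<close> replaces it:
  \<open>R\<^sub>z\<^sub>+\<^sub>u\<close> takes \<open>u\<close> to \<open>- z\<close>, and \<open>R\<^sub>w\<^sub>+\<^sub>z\<close> takes \<open>- z\<close> to \<open>w\<close>.  The sums are timelike because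
  \<open>\<langle>z + u, z + u\<rangle> = 2 \<langle>z, u\<rangle>\<close>.
\<close>

lemma null_transitive:
  fixes t :: "'n::finite"
  assumes "CARD('n) \<ge> 2" "mink t u u = 0" "mink t w w = 0" "mink t z z = 0"
    and "u $ t > 0" "w $ t > 0" "z $ t > 0" "mink t z u > 0" "mink t z w > 0"
  shows "\<exists>L\<in>SO0_lorentz t. L *v u = w"
proof
  have T: "w + z \<in> future_timelike t" "z + u \<in> future_timelike t"
    using assms by (auto simp: future_timelike_def mink_commute [of t u z] mink_commute [of t w z])
  then show "reflection t (w + z) ** reflection t (z + u) \<in> SO0_lorentz t"
    using assms by (intro reflection_pair_SO0)
  have "reflection t (z + u) *v u = - z" "reflection t (w + z) *v z = - w"
    using T assms by (intro reflection_sum; auto simp: future_timelike_def)+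
  then show "(reflection t (w + z) ** reflection t (z + u)) *v u = w"
    by (simp flip: matrix_vector_mul_assoc add: vec.neg)
qed

section \<open>Invariance of the time orientation\<close>

lemma causal_time_nonzero:
  assumes "mink t v v \<ge> 0" "v \<noteq> 0"
  shows "v $ t \<noteq> 0"
proof
  assume "v $ t = 0"
  then have "(\<Sum>i\<in>UNIV - {t}. v $ i * v $ i) \<le> 0"
    using assms(1) by (simp add: mink_expand)
  then have "\<forall>i\<in>UNIV - {t}. v $ i * v $ i = 0"
    by (subst sum_nonneg_eq_0_iff [symmetric]) (auto intro!: antisym sum_nonneg)
  then have "v = 0"
    using \<open>v $ t = 0\<close> by (auto simp: vec_eq_iff)
  with assms show False by simp
qed

lemma SO_causal_time_nonzero:
  assumes "L \<in> SO_lorentz t" "mink t v v \<ge> 0" "v \<noteq> 0"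
  shows "(L *v v) $ t \<noteq> 0"
proof (rule causal_time_nonzero)
  show "mink t (L *v v) (L *v v) \<ge> 0"
    using assms by (simp add: SO_lorentz_iff O_lorentz_iff)
  obtain K where "K ** L = mat 1"
    using SO_lorentz_inverse assms(1) by metis
  then have "K *v (L *v v) = v"
    by (simp add: matrix_vector_mul_assoc)
  with assms(3) show "L *v v \<noteq> 0" by auto
qed

text \<open>
  On the connected set \<open>SO\<^sub>0(1,n-1)\<close> the continuous function \<open>L \<mapsto> (L v)\<^sub>0\<close> has no zero, since
  \<open>L v\<close> is again nonzero and causal, and it is positive at the identity.
\<close>

lemma SO0_preserves_future:
  assumes "L \<in> SO0_lorentz t" "mink t v v \<ge> 0" "v $ t > 0"
  shows "(L *v v) $ t > 0"
proof (rule ccontr)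
  let ?f = "\<lambda>L :: real ^ 'a ^ 'a. (L *v v) $ t"
  assume "\<not> ?f L > 0"
  have "connected (?f ` SO0_lorentz t)"
    by (intro connected_continuous_image connected_SO0)
       (simp add: matrix_vector_mult_def, intro continuous_intros)
  moreover have "?f L \<in> ?f ` SO0_lorentz t"
    using assms by blast
  moreover have "?f (mat 1) \<in> ?f ` SO0_lorentz t"
    using mat_1_SO0 by blast
  moreover have "?f L \<le> 0" "0 \<le> ?f (mat 1)"
    using assms \<open>\<not> ?f L > 0\<close> by auto
  ultimately have "0 \<in> ?f ` SO0_lorentz t"
    unfolding connected_iff_interval by blast
  moreover have "v \<noteq> 0" using assms(3) by auto
  ultimately show False
    using SO_causal_time_nonzero [of _ t v] assms(2) SO0_subset by fastforce
qed

section \<open>Transitivity on vectors of a given square\<close>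

lemma mink_plane_plane: "t \<noteq> x \<Longrightarrow> mink t (plane t x a b) (plane t x c d) = a * c - b * d"
  by (simp add: mink_plane plane_nth)

text \<open>
  The product of the reflections along the two coordinate axes of the plane.  It connects the
  future to the past within \<open>SO(1,n-1)\<close>.
\<close>

lemma plane_neg_SO:
  fixes t x :: "'n::finite"
  assumes "CARD('n) \<ge> 2" "t \<noteq> x"
  obtains M where "M \<in> SO_lorentz t" "\<And>a b. M *v plane t x a b = - plane t x a b"
proof
  let ?M = "reflection t (plane t x 1 0) ** reflection t (plane t x 0 1)"
  show "?M \<in> SO_lorentz t"
    using assms by (intro reflection_pair_SO) (auto simp: mink_plane_plane)
  show "?M *v plane t x a b = - plane t x a b" for a b
    using assms(2)
    by (simp add: reflection_apply mink_plane vec_eq_iff plane_nth flip: matrix_vector_mul_assoc)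
qed

text \<open>
  A single reflection does almost all: \<open>R\<^sub>u\<^sub>-\<^sub>w w = u\<close> or \<open>R\<^sub>u\<^sub>+\<^sub>w w = - u\<close>, where \<open>w = (a, b)\<close>.
  Not both of \<open>u - w\<close> and \<open>u + w\<close> are null, since their squares add up to \<open>4 \<langle>u, u\<rangle>\<close>.  The
  reflection along \<open>(b, a)\<close>, which fixes \<open>w\<close>, repairs the determinant.
\<close>

lemma nonnull_transitive:
  fixes t x :: "'n::finite"
  assumes "CARD('n) \<ge> 2" "t \<noteq> x" "mink t u u = a\<^sup>2 - b\<^sup>2" "mink t u u \<noteq> 0"
  shows "\<exists>L\<in>SO_lorentz t. L *v plane t x a b = u"
proof -
  let ?w = "plane t x a b" and ?e = "plane t x b a"
  obtain M where M: "M \<in> SO_lorentz t" "M *v ?w = - ?w"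
    using plane_neg_SO assms(1,2) by metis
  have ww: "mink t ?w ?w = mink t u u"
    using assms by (simp add: mink_plane_plane power2_eq_square)
  have ee: "mink t ?e ?e \<noteq> 0"
    using assms(2-4) by (simp add: mink_plane_plane power2_eq_square)
  have e: "reflection t ?e *v ?w = ?w"
    using assms(2) by (intro reflection_fix) (simp add: mink_plane_plane)
  show ?thesis
  proof (cases "mink t (u - ?w) (u - ?w) = 0")
    case False
    then show ?thesis
      using assms ww ee by (intro bexI [of _ "reflection t (u - ?w) ** reflection t ?e"] reflection_pair_SO)
        (simp_all add: e reflection_diff flip: matrix_vector_mul_assoc)
  next
    case True
    then have ne: "mink t (u + ?w) (u + ?w) \<noteq> 0"
      using assms(4) ww by (simp add: mink_commute [of t ?w u])
    have "reflection t (u + ?w) ** reflection t ?e ** M \<in> SO_lorentz t"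
      using assms(1) ne ee M(1) by (intro SO_lorentz_mult reflection_pair_SO)
    moreover have "(reflection t (u + ?w) ** reflection t ?e ** M) *v ?w = u"
      using ne ww by (simp add: M(2) e reflection_sum vec.neg flip: matrix_vector_mul_assoc)
    ultimately show ?thesis by blast
  qed
qed

lemma UNIV_two:
  fixes t x :: "'n::finite"
  assumes "CARD('n) = 2" "t \<noteq> x"
  shows "UNIV = {t, x}"
  using assms by (intro card_seteq [symmetric]) auto

text \<open>
  In at least three dimensions a null vector for \<open>null_transitive\<close> can be found among
  \<open>(1, -1, 0)\<close> and \<open>(1, 0, 1)\<close>, coordinates referring to the indices \<open>t\<close>, \<open>x\<close> and some third \<open>y\<close>.
  The first one fails only if \<open>u\<close> is parallel to it, and then the second one works.
\<close>

lemma null_companion: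
  fixes t x :: "'n::finite"
  assumes "CARD('n) > 2" "t \<noteq> x" "mink t u u = 0" "u $ t > 0"
  shows "\<exists>z. mink t z z = 0 \<and> z $ t > 0 \<and> mink t z u > 0 \<and> mink t z (plane t x (1/2) (1/2)) > 0"
proof -
  have "card {t, x} < CARD('n)" using assms(1,2) by simp
  then have "{t, x} \<noteq> UNIV" by force
  then obtain y where y: "y \<noteq> t" "y \<noteq> x" by blast
  have "(u $ x)\<^sup>2 + (u $ y)\<^sup>2 = (\<Sum>i\<in>{x, y}. u $ i * u $ i)"
    using y by (simp add: power2_eq_square)
  also have "\<dots> \<le> (\<Sum>i\<in>UNIV - {t}. u $ i * u $ i)"
    using assms(2) y by (intro sum_mono2) auto
  finally have le: "(u $ x)\<^sup>2 + (u $ y)\<^sup>2 \<le> (u $ t)\<^sup>2"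
    using assms(3) by (simp add: mink_expand power2_eq_square)
  show ?thesis
  proof (cases "u $ t + u $ x > 0")
    case True
    with assms(2) show ?thesis
      by (intro exI [of _ "plane t x 1 (-1)"]) (simp add: mink_plane plane_nth)
  next
    case False
    then have "(u $ t)\<^sup>2 \<le> (u $ x)\<^sup>2"
      using assms(4) by (intro abs_le_square_iff [THEN iffD1]) auto
    with le have "(u $ y)\<^sup>2 \<le> 0" by linarith
    then have "u $ y = 0" by simp
    with assms(2,4) y show ?thesis
      by (intro exI [of _ "plane t y 1 1"]) (simp add: mink_plane plane_nth)
  qed
qed

text \<open>
  In two dimensions the condition places \<open>u\<close> on the same null line as \<open>(1/2, 1/2)\<close>; the vector
  \<open>z\<close> of \<open>null_transitive\<close> is then taken from the other null line.
\<close>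

lemma null_canonical_future:
  fixes t x :: "'n::finite"
  assumes "CARD('n) \<ge> 2" "t \<noteq> x" "mink t u u = 0" "u $ t > 0"
    and "CARD('n) = 2 \<Longrightarrow> u $ x = u $ t"
  shows "\<exists>L\<in>SO0_lorentz t. L *v plane t x (1/2) (1/2) = u"
proof -
  have "\<exists>z. mink t z z = 0 \<and> z $ t > 0 \<and> mink t z u > 0 \<and> mink t z (plane t x (1/2) (1/2)) > 0"
  proof (cases "CARD('n) = 2")
    case True
    with assms show ?thesis
      by (intro exI [of _ "plane t x 1 (-1)"]) (simp add: mink_plane plane_nth)
  next
    case False
    with assms(1) show ?thesis by (intro null_companion assms) auto
  qed
  then show ?thesis
    using assms(1-4) null_transitive [of t "plane t x (1/2) (1/2)" u]
    by (auto simp: mink_plane_plane plane_nth)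
qed

text \<open>
  Past vectors are reduced to future ones by \<open>plane_neg_SO\<close>.
\<close>

lemma null_canonical:
  fixes t x :: "'n::finite"
  assumes "CARD('n) \<ge> 2" "t \<noteq> x" "mink t u u = 0" "u \<noteq> 0"
  shows "(\<exists>L\<in>SO_lorentz t. L *v plane t x (1/2) (1/2) = u) \<or>
    CARD('n) = 2 \<and> (\<exists>L\<in>SO_lorentz t. L *v plane t x (1/2) (- 1/2) = u)"
proof -
  have future: "(\<exists>L\<in>SO_lorentz t. L *v plane t x (1/2) (1/2) = u) \<or>
    CARD('n) = 2 \<and> (\<exists>L\<in>SO_lorentz t. L *v plane t x (1/2) (- 1/2) = u)"
    if u: "mink t u u = 0" "u $ t > 0" for u
  proof (cases "CARD('n) = 2 \<and> u $ x \<noteq> u $ t")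
    case False
    then show ?thesis
      using null_canonical_future [OF assms(1,2) u] SO0_subset by blast
  next
    case True
    have "UNIV - {t} = {x}"
      using UNIV_two [OF _ assms(2)] True assms(2) by auto
    then have "(u $ t - u $ x) * (u $ t + u $ x) = 0"
      using u by (simp add: mink_expand algebra_simps)
    with True have "u $ x = - u $ t" by auto
    then have "\<exists>L\<in>SO0_lorentz t. L *v plane t x (1/2) (- 1/2) = u"
      using null_transitive [of t "plane t x (1/2) (- 1/2)" u "plane t x 1 1"] assms(1,2) u
      by (simp add: mink_plane plane_nth)
    with True SO0_subset show ?thesis by blast
  qed
  obtain M where M: "M \<in> SO_lorentz t" "\<And>a b. M *v plane t x a b = - plane t x a b"
    using plane_neg_SO assms(1,2) by metis
  have neg: "\<exists>K\<in>SO_lorentz t. K *v plane t x a b = u"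
    if "L \<in> SO_lorentz t" "L *v plane t x a b = - u" for L a b
    using that M by (intro bexI [of _ "L ** M"])
      (simp_all add: SO_lorentz_mult vec.neg flip: matrix_vector_mul_assoc)
  have "u $ t \<noteq> 0"
    using assms by (intro causal_time_nonzero) auto
  then consider "u $ t > 0" | "(- u) $ t > 0" by fastforce
  then show ?thesis
  proof cases
    case 1
    then show ?thesis using future assms(3) by blast
  next
    case 2
    have "mink t (- u) (- u) = 0" using assms(3) by simp
    from future [OF this 2] show ?thesis using neg by blast
  qed
qed

lemma det_two:
  assumes "UNIV = {t, x}" "t \<noteq> x"
  shows "det A = A $ t $ t * A $ x $ x - A $ t $ x * A $ x $ t"
proof -
  have f: "finite {x}" "t \<notin> {x}" using assms(2) by auto
  show ?thesis
    unfolding det_def assms(1)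
    unfolding sum_over_permutations_insert [OF f]
    unfolding permutes_sing
    using assms(2) by (simp add: sign_swap_id sign_id swap_id_eq)
qed

text \<open>
  In two dimensions the equations defining \<open>SO(1,1)\<close> force the matrix to have the form
  \<open>((p, q), (q, p))\<close>, so that \<open>(1/2, 1/2)\<close> is an eigenvector: the two null lines cannot be
  exchanged, although \<open>O(1,1)\<close> does so.
\<close>

lemma SO_two_null_line:
  fixes t x :: "'n::finite"
  assumes "CARD('n) = 2" "t \<noteq> x" "L \<in> SO_lorentz t"
  shows "(L *v plane t x (1/2) (1/2)) $ x = (L *v plane t x (1/2) (1/2)) $ t"
proof -
  note U = UNIV_two [OF assms(1,2)]
  have D: "UNIV - {t} = {x}" using U assms(2) by auto
  define p q r s where "p = L $ t $ t" and "q = L $ t $ x" and "r = L $ x $ t" and "s = L $ x $ x"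
  note defs = p_def q_def r_def s_def
  have Lv: "(L *v plane t x a b) $ i = L $ i $ t * a + L $ i $ x * b" for a b i
    using assms(2) by (simp add: matrix_vector_mult_def U plane_nth)
  have inv: "mink t (L *v u) (L *v v) = mink t u v" for u v
    using assms(3) by (simp add: SO_lorentz_iff O_lorentz_iff)
  have "p * p - r * r = 1"
    using inv [of "plane t x 1 0" "plane t x 1 0"] assms(2)
    by (simp add: mink_expand D Lv plane_nth defs)
  moreover have "q * q - s * s = - 1"
    using inv [of "plane t x 0 1" "plane t x 0 1"] assms(2)
    by (simp add: mink_expand D Lv plane_nth defs)
  moreover have "p * q - r * s = 0"
    using inv [of "plane t x 1 0" "plane t x 0 1"] assms(2)
    by (simp add: mink_expand D Lv plane_nth defs)
  moreover have "p * s - q * r = 1"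
    using assms(3) det_two [OF U assms(2), of L] by (simp add: SO_lorentz_iff defs)
  ultimately have "p = s" "q = r"
    by algebra+
  then show ?thesis by (simp add: Lv defs)
qed

section \<open>Orbits\<close>

lemma act_act: "act l L (act m M A) = act (l + m) (L ** M) A"
proof -
  have "exp (- (l + m)) = exp (- l) * exp (- m)"
    by (simp flip: exp_add)
  then show ?thesis
    by (simp add: act_def matrix_vector_mult_scaleR distrib_left exp_add flip: matrix_vector_mul_assoc)
qed

lemma orbitI: "L \<in> H \<Longrightarrow> act l L A \<in> orbit H A"
  by (auto simp: orbit_def)

lemma orbitE:
  assumes "B \<in> orbit H A"
  obtains l L where "L \<in> H" "B = act l L A"
  using assms by (auto simp: orbit_def)

lemma orbit_SO0_eq:
  assumes "B \<in> orbit (SO0_lorentz t) A"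
  shows "orbit (SO0_lorentz t) B = orbit (SO0_lorentz t) A"
proof -
  have sub: "orbit (SO0_lorentz t) B \<subseteq> orbit (SO0_lorentz t) A" if "B \<in> orbit (SO0_lorentz t) A" for A B
    using that by (auto elim!: orbitE simp: act_act intro!: orbitI SO0_mult)
  obtain l L where L: "L \<in> SO0_lorentz t" "B = act l L A"
    using assms by (rule orbitE)
  obtain K where K: "K \<in> SO0_lorentz t" "K ** L = mat 1"
    using L(1) by (rule SO0_inverse)
  have "A = act (- l) K B"
    by (simp add: L(2) act_act K(2)) (simp add: act_def)
  then have "A \<in> orbit (SO0_lorentz t) B"
    using orbitI [OF K(1)] by metis
  then show ?thesis
    using sub assms by blast
qed

text \<open>
  The orbit is the image of the connected set \<open>\<real> \<times> SO\<^sub>0(1,n-1)\<close>.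
\<close>

lemma connected_orbit_SO0: "connected (orbit (SO0_lorentz t) A)"
proof -
  have "orbit (SO0_lorentz t) A = (\<lambda>(l, L). act l L A) ` (UNIV \<times> SO0_lorentz t)"
    by (simp add: orbit_def image_def) blast
  also have "connected \<dots>"
    unfolding act_def matrix_vector_mult_def case_prod_unfold
    by (intro connected_continuous_image connected_Times connected_UNIV connected_SO0
        continuous_intros continuous_on_vec_lambda)
  finally show ?thesis .
qed

definition negate_vector :: "real \<times> (real ^ 'n) \<Rightarrow> real \<times> (real ^ 'n::finite)" where
  "negate_vector A = (fst A, - snd A)"

lemma negate_vector_simps [simp]: "negate_vector (negate_vector A) = A" "snd (negate_vector A) = - snd A" "fst (negate_vector A) = fst A"
  by (simp_all add: negate_vector_def)

lemma negate_vector_act: "negate_vector (act l L A) = act l L (negate_vector A)"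
  by (simp add: negate_vector_def act_def vec.neg)

lemma orbit_reverse: "orbit H (negate_vector A) = negate_vector ` orbit H A"
  by (simp add: orbit_def negate_vector_act [symmetric]) blast

section \<open>Splitting of orbits into future and past\<close>

lemma image_two_pieces:
  assumes "U \<noteq> {}" "V \<noteq> {}" "\<And>a. a \<in> U \<Longrightarrow> g a = X" "\<And>a. a \<in> V \<Longrightarrow> g a = Y"
  shows "g ` (U \<union> V) = {X, Y}"
proof -
  have "g ` U = {X}" "g ` V = {Y}"
    using assms by (auto intro!: image_eqI [OF sym])
  then show ?thesis by (simp add: image_Un insert_is_Un [of X "{Y}"])
qed

text \<open>
  A connected subset meeting both \<open>U\<close> and \<open>V\<close> would contain a zero of \<open>f\<close>.
\<close>

lemma components_two_signs:
  assumes S: "S = U \<union> V" and U: "connected U" "U \<noteq> {}" and V: "connected V" "V \<noteq> {}"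
    and f: "continuous_on S (f :: _ \<Rightarrow> real)" "\<And>a. a \<in> U \<Longrightarrow> f a > 0" "\<And>a. a \<in> V \<Longrightarrow> f a < 0"
  shows "components S = {U, V}"
proof -
  have one_sign: "C \<subseteq> U \<or> C \<subseteq> V" if C: "connected C" "C \<subseteq> S" for C
  proof (rule ccontr)
    assume "\<not> (C \<subseteq> U \<or> C \<subseteq> V)"
    then obtain a b where ab: "a \<in> C" "a \<in> U" "b \<in> C" "b \<in> V"
      using C S by blast
    have "connected (f ` C)"
      using C f(1) by (intro connected_continuous_image) (auto intro: continuous_on_subset)
    moreover have "f b \<in> f ` C" "f a \<in> f ` C" "f b \<le> 0" "0 \<le> f a"
      using ab f(2,3) by (auto intro: less_imp_le)
    ultimately have "0 \<in> f ` C"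
      unfolding connected_iff_interval by blast
    then show False
      using f(2,3) C(2) S by fastforce
  qed
  have disj: "U \<inter> V = {}"
    using f(2,3) by fastforce
  have "connected_component_set S a = U" if "a \<in> U" for a
    using that S U disj one_sign by (intro connected_component_unique) blast+
  moreover have "connected_component_set S a = V" if "a \<in> V" for a
    using that S V disj one_sign by (intro connected_component_unique) blast+
  ultimately show ?thesis
    unfolding components_def S using S U(2) V(2) by (intro image_two_pieces) auto
qed

text \<open>
  The common core of the null and the timelike case.  Transitivity is needed only in the form
  \<open>trans\<close>: a future vector reached from the base vector by \<open>SO(1,n-1)\<close> is reached by the identity
  component too.  This weak form also holds in two dimensions, where the identity component is not
  transitive on the future light cone.  Both parts turn out to be topological components even for
  null vectors.
\<close>

lemma orbit_splitting:
  fixes t x :: "'n::finite" and C :: "real \<times> (real ^ 'n)"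
  defines "Orb \<equiv> orbit (SO_lorentz t) C"
  assumes n: "CARD('n) \<ge> 2" "t \<noteq> x"
    and C: "C = (c, plane t x a b)" "a > 0" "a\<^sup>2 \<ge> b\<^sup>2"
    and trans: "\<And>L. L \<in> SO_lorentz t \<Longrightarrow> (L *v plane t x a b) $ t > 0
      \<Longrightarrow> \<exists>K\<in>SO0_lorentz t. K *v plane t x a b = L *v plane t x a b"
    and F: "\<And>B. B \<in> Orb \<Longrightarrow> B \<in> F \<longleftrightarrow> snd B $ t > 0"
    and P: "\<And>B. B \<in> Orb \<Longrightarrow> B \<in> P \<longleftrightarrow> snd B $ t < 0"
  shows "splits_into_components t C F P"
proof -
  let ?v = "plane t x a b"
  define U V where "U = Orb \<inter> F" and "V = Orb \<inter> P"
  have v: "mink t ?v ?v \<ge> 0" "?v $ t > 0" "?v \<noteq> 0"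
    using n(2) C by (auto simp: mink_plane_plane power2_eq_square plane_nth vec_eq_iff)
  have U_iff: "B \<in> U \<longleftrightarrow> B \<in> Orb \<and> snd B $ t > 0" for B
    using F [of B] unfolding U_def by blast
  have V_iff: "B \<in> V \<longleftrightarrow> B \<in> Orb \<and> snd B $ t < 0" for B
    using P [of B] unfolding V_def by blast
  have OUV: "Orb = U \<union> V"
  proof -
    have "snd B $ t \<noteq> 0" if "B \<in> Orb" for B
      using that SO_causal_time_nonzero [OF _ v(1,3)]
      by (auto simp: Orb_def C(1) act_def elim!: orbitE)
    then show ?thesis
      unfolding set_eq_iff Un_iff U_iff V_iff by (metis neq_iff)
  qed
  \<comment> \<open>The future part is the orbit of the base element under the identity component.\<close>
  have orbit_C: "orbit (SO0_lorentz t) C = U"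
  proof (intro equalityI subsetI)
    fix B assume "B \<in> orbit (SO0_lorentz t) C"
    then obtain l L where L: "L \<in> SO0_lorentz t" "B = act l L C"
      by (rule orbitE)
    moreover have "(L *v ?v) $ t > 0"
      using L(1) v by (intro SO0_preserves_future)
    ultimately have "snd B $ t > 0"
      by (simp add: C(1) act_def)
    moreover have "B \<in> Orb"
      unfolding Orb_def L(2) using L(1) SO0_subset by (intro orbitI) blast
    ultimately show "B \<in> U" by (simp add: U_iff)
  next
    fix B assume "B \<in> U"
    then obtain l L where L: "L \<in> SO_lorentz t" "B = act l L C" and "snd B $ t > 0"
      by (auto simp: U_iff Orb_def elim: orbitE)
    then have "(L *v ?v) $ t > 0"
      by (simp add: C(1) act_def zero_less_mult_iff)
    then obtain K where "K \<in> SO0_lorentz t" "K *v ?v = L *v ?v"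
      using trans L(1) by blast
    moreover from this have "B = act l K C"
      by (simp add: L(2) C(1) act_def)
    ultimately show "B \<in> orbit (SO0_lorentz t) C"
      by (simp add: orbitI)
  qed
  \<comment> \<open>The orbit is symmetric under \<open>negate_vector\<close>, which therefore carries the future part to the past part.\<close>
  have Orb_rev: "negate_vector B \<in> Orb" if B: "B \<in> Orb" for B
  proof -
    obtain l L where L: "L \<in> SO_lorentz t" "B = act l L C"
      using B unfolding Orb_def by (rule orbitE)
    obtain M where M: "M \<in> SO_lorentz t" "\<And>a b. M *v plane t x a b = - plane t x a b"
      using plane_neg_SO [OF n] by metis
    have "negate_vector C = act 0 M C"
      by (simp add: C(1) M(2) act_def negate_vector_def)
    then have "negate_vector B = act l (L ** M) C"
      by (simp add: L(2) negate_vector_act act_act)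
    then show ?thesis
      using L(1) M(1) by (simp add: Orb_def orbitI SO_lorentz_mult)
  qed
  have V_rev: "V = negate_vector ` U"
  proof (intro equalityI subsetI)
    fix B assume "B \<in> V"
    then show "B \<in> negate_vector ` U"
      using Orb_rev [of B] by (intro image_eqI [of _ _ "negate_vector B"]) (auto simp: U_iff V_iff)
  qed (use Orb_rev in \<open>auto simp: U_iff V_iff\<close>)
  have orbit_U: "orbit (SO0_lorentz t) B = U" if "B \<in> U" for B
    using that orbit_SO0_eq unfolding orbit_C [symmetric] by blast
  have orbit_V: "orbit (SO0_lorentz t) B = V" if "B \<in> V" for B
    using that orbit_U by (auto simp: V_rev orbit_reverse)
  have ne: "C \<in> U" "negate_vector C \<in> V"
  proof -
    have "C = act 0 (mat 1) C" by (simp add: act_def)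
    then show "C \<in> U"
      unfolding orbit_C [symmetric] using orbitI [OF mat_1_SO0] by metis
    then show "negate_vector C \<in> V" by (simp add: V_rev)
  qed
  have "orbit (SO0_lorentz t) ` Orb = {U, V}"
    unfolding OUV using ne orbit_U orbit_V by (intro image_two_pieces) auto
  moreover have "U \<noteq> V"
    using ne(1) U_iff [of C] V_iff [of C] by force
  ultimately have "splits_into t C F P"
    by (simp add: splits_into_def U_def V_def Orb_def)
  moreover have "components Orb = {U, V}"
  proof (rule components_two_signs [OF OUV])
    show "connected U"
      unfolding orbit_C [symmetric] by (rule connected_orbit_SO0)
    show "connected V"
      using connected_orbit_SO0 [of t "negate_vector C"] by (simp add: orbit_V ne)
    show "continuous_on Orb (\<lambda>B. snd B $ t)"
      by (intro continuous_intros)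
    show "U \<noteq> {}" "V \<noteq> {}"
      using ne by blast+
  qed (simp_all add: U_iff V_iff)
  ultimately show ?thesis
    by (simp add: splits_into_components_def U_def V_def Orb_def)
qed

lemma mink_orbit:
  assumes "B \<in> orbit (SO_lorentz t) (c, v)"
  shows "\<exists>r>0. mink t (snd B) (snd B) = r * mink t v v"
proof -
  obtain l L where "L \<in> SO_lorentz t" "B = act l L (c, v)"
    using assms by (rule orbitE)
  then show ?thesis
    by (intro exI [of _ "exp (- l) * exp (- l)"]) (simp add: act_def SO_lorentz_iff O_lorentz_iff)
qed

lemma timelike_splitting:
  fixes t x :: "'n::finite"
  assumes n: "CARD('n) \<ge> 2" "t \<noteq> x" and a: "a > 0" "a\<^sup>2 > b\<^sup>2"
  shows "splits_into_components t (elt t x c a b) (future_hyperboloids t) (past_hyperboloids t)"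
proof (rule orbit_splitting [OF n elt_plane a(1)])
  let ?v = "plane t x a b"
  have v: "mink t ?v ?v > 0" "?v $ t > 0"
    using n(2) a by (auto simp: mink_plane_plane power2_eq_square plane_nth)
  show "\<exists>K\<in>SO0_lorentz t. K *v ?v = L *v ?v" if "L \<in> SO_lorentz t" "(L *v ?v) $ t > 0" for L
    using that v n(1)
    by (intro timelike_transitive) (auto simp: future_timelike_def SO_lorentz_iff O_lorentz_iff)
  have pos: "mink_sq t (snd B) > 0" if "B \<in> orbit (SO_lorentz t) (elt t x c a b)" for B
    using mink_orbit [OF that [unfolded elt_plane]] v(1) by (auto simp: mink_sq_mink)
  show "B \<in> future_hyperboloids t \<longleftrightarrow> snd B $ t > 0" if "B \<in> orbit (SO_lorentz t) (elt t x c a b)" for B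
    using pos [OF that] by (simp add: future_hyperboloids_def)
  show "B \<in> past_hyperboloids t \<longleftrightarrow> snd B $ t < 0" if "B \<in> orbit (SO_lorentz t) (elt t x c a b)" for B
    using pos [OF that] by (simp add: past_hyperboloids_def)
qed (use a in simp)

lemma null_splitting:
  fixes t x :: "'n::finite"
  assumes n: "CARD('n) \<ge> 2" "t \<noteq> x"
  shows "splits_into t (elt t x c (1/2) (1/2)) (future_cone t) (past_cone t)"
proof -
  let ?v = "plane t x (1/2) (1/2)"
  have v: "mink t ?v ?v = 0"
    using n(2) by (simp add: mink_plane_plane)
  have "splits_into_components t (elt t x c (1/2) (1/2)) (future_cone t) (past_cone t)"
  proof (rule orbit_splitting [OF n elt_plane])
    show "\<exists>K\<in>SO0_lorentz t. K *v ?v = L *v ?v" if "L \<in> SO_lorentz t" "(L *v ?v) $ t > 0" for L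
      using that v n SO_two_null_line [of t x L]
      by (intro null_canonical_future) (auto simp: SO_lorentz_iff O_lorentz_iff)
    have zero: "mink_sq t (snd B) = 0" if "B \<in> orbit (SO_lorentz t) (elt t x c (1/2) (1/2))" for B
      using mink_orbit [OF that [unfolded elt_plane]] v by (auto simp: mink_sq_mink)
    show "B \<in> future_cone t \<longleftrightarrow> snd B $ t > 0" if "B \<in> orbit (SO_lorentz t) (elt t x c (1/2) (1/2))" for B
      using zero [OF that] by (simp add: future_cone_def)
    show "B \<in> past_cone t \<longleftrightarrow> snd B $ t < 0" if "B \<in> orbit (SO_lorentz t) (elt t x c (1/2) (1/2))" for B
      using zero [OF that] by (simp add: past_cone_def)
  qed simp_all
  then show ?thesis by (simp add: splits_into_components_def)
qed

section \<open>Canonical forms\<close>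

lemma in_orbitI:
  assumes "L \<in> SO_lorentz t" "L *v w = exp l *\<^sub>R v" "a = exp (2 * l) * c"
  shows "(a, v) \<in> orbit (SO_lorentz t) (c, w)"
proof -
  have "(a, v) = act l L (c, w)"
    using assms(2,3) by (simp add: act_def flip: exp_add)
  then show ?thesis using assms(1) by (metis orbitI)
qed

lemma scale_to_unit:
  fixes a :: real
  assumes "a \<noteq> 0"
  obtains l where "a = exp (2 * l) * sgn a" "exp (2 * l) = \<bar>a\<bar>"
  using assms that [of "ln \<bar>a\<bar> / 2"] by (simp add: abs_mult_sgn)

text \<open>
  Since \<open>sgn 0 = 0\<close>, this covers both the elements of rank 1 with \<open>a = 0\<close> and those of rank 2
  with \<open>a \<noteq> 0\<close>.  The scaling that normalises \<open>a\<close> also rescales the null vector, but this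
  is harmless: boosts rescale null vectors as well.
\<close>

lemma orbit_null:
  fixes t x :: "'n::finite"
  assumes n: "CARD('n) \<ge> 2" "t \<noteq> x" and v: "mink t v v = 0" "v \<noteq> 0"
  shows "(a, v) \<in> orbit (SO_lorentz t) (elt t x (sgn a) (1/2) (1/2)) \<or>
    CARD('n) = 2 \<and> (a, v) \<in> orbit (SO_lorentz t) (elt t x (sgn a) (1/2) (- 1/2))"
proof -
  obtain l where l: "a = exp (2 * l) * sgn a"
    by (cases "a = 0") (auto elim: scale_to_unit)
  have "mink t (exp l *\<^sub>R v) (exp l *\<^sub>R v) = 0" "exp l *\<^sub>R v \<noteq> 0"
    using v by auto
  from null_canonical [OF n this] show ?thesis
    using in_orbitI [OF _ _ l] unfolding elt_plane by blast
qed

text \<open>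
  The parameter \<open>l\<close> has to be compatible with the scalar part and with the square of the vector
  part at once; for rank 3 this is achieved by choosing \<open>k\<close>, for rank 2 the scalar part is \<open>0\<close>.
\<close>

lemma orbit_nonnull:
  fixes t x :: "'n::finite"
  assumes n: "CARD('n) \<ge> 2" "t \<noteq> x" and v: "mink t v v \<noteq> 0"
    and l: "a = exp (2 * l) * c" "exp (2 * l) * mink t v v = p\<^sup>2 - q\<^sup>2"
  shows "(a, v) \<in> orbit (SO_lorentz t) (elt t x c p q)"
proof -
  have "mink t (exp l *\<^sub>R v) (exp l *\<^sub>R v) = p\<^sup>2 - q\<^sup>2"
    using l(2) by (simp add: exp_double power2_eq_square)
  moreover have "mink t (exp l *\<^sub>R v) (exp l *\<^sub>R v) \<noteq> 0"
    using v by simp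
  ultimately obtain L where "L \<in> SO_lorentz t" "L *v plane t x p q = exp l *\<^sub>R v"
    using nonnull_transitive [OF n] by blast
  then show ?thesis
    unfolding elt_plane using l(1) by (rule in_orbitI)
qed

lemma raise_eq_0_iff: "raise t v = 0 \<longleftrightarrow> v = 0"
  by (auto simp: vec_eq_iff raise_nth)

lemma rank1_canonical:
  fixes t x :: "'n::finite"
  assumes n: "CARD('n) \<ge> 2" "t \<noteq> x" and A: "rank1 t A"
  shows "A \<in> orbit (SO_lorentz t) A1a \<or> A \<in> orbit (SO_lorentz t) A1b \<or>
    A \<in> orbit (SO_lorentz t) (A1c t x) \<or> CARD('n) = 2 \<and> A \<in> orbit (SO_lorentz t) (E3 t x)"
proof -
  obtain a v where av: "A = (a, v)" by fastforce
  have v: "mink t v v = 0" "a = 0 \<or> v = 0" "a \<noteq> 0 \<or> v \<noteq> 0"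
    using A by (auto simp: av rank1_def adjoint_sharp_def mink_sq_mink raise_eq_0_iff zero_prod_def)
  show ?thesis
  proof (cases "v = 0")
    case True
    with v obtain l where "a = exp (2 * l) * sgn a"
      by (auto elim: scale_to_unit)
    then have "A \<in> orbit (SO_lorentz t) (sgn a, 0)"
      unfolding av True by (intro in_orbitI [OF mat_1_SO]) auto
    with True v(3) show ?thesis by (auto simp: A1a_def A1b_def sgn_if split: if_splits)
  next
    case False
    with v(2) have "a = 0" by blast
    with orbit_null [OF n v(1) False, of a] show ?thesis
      by (simp add: av A1c_def E3_def)
  qed
qed

lemma rank2_canonical:
  fixes t x :: "'n::finite"
  assumes n: "CARD('n) \<ge> 2" "t \<noteq> x" and A: "rank2 t A"
  shows "A \<in> orbit (SO_lorentz t) (A2a t x) \<or> A \<in> orbit (SO_lorentz t) (A2b t x) \<or>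
    A \<in> orbit (SO_lorentz t) (A2c t x) \<or> A \<in> orbit (SO_lorentz t) (A2d t x) \<or>
    CARD('n) = 2 \<and> (A \<in> orbit (SO_lorentz t) (E1 + E3 t x) \<or> A \<in> orbit (SO_lorentz t) (- E1 + E3 t x))"
proof -
  obtain a v where av: "A = (a, v)" by fastforce
  have E: "E1 + E3 t x = elt t x 1 (1/2) (- 1/2)" "- E1 + E3 t x = elt t x (- 1) (1/2) (- 1/2)"
    by (simp_all add: E1_def E3_def elt_def)
  have v: "a = 0 \<or> mink t v v = 0" "mink t v v \<noteq> 0 \<or> a \<noteq> 0 \<and> v \<noteq> 0"
    using A by (auto simp: av rank2_def cubic_norm_def adjoint_sharp_def mink_sq_mink raise_eq_0_iff zero_prod_def)
  show ?thesis
  proof (cases "mink t v v = 0")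
    case True
    with v have "a \<noteq> 0" "v \<noteq> 0" by auto
    with orbit_null [OF n True, of a] show ?thesis
      unfolding E by (auto simp: av A2c_def A2d_def sgn_if split: if_splits)
  next
    case False
    with v have a: "a = 0" by blast
    \<comment> \<open>With \<open>a = 0\<close> the whole freedom of \<open>l\<close> goes into normalising the square to \<open>1\<close> or \<open>- 1\<close>.\<close>
    obtain l where "exp (2 * l) = \<bar>1 / mink t v v\<bar>"
      using scale_to_unit [of "1 / mink t v v"] False by auto
    then have l: "exp (2 * l) * mink t v v = sgn (mink t v v)"
      using False by (simp add: sgn_if abs_if)
    show ?thesis
    proof (cases "mink t v v > 0")
      case True
      then have "A \<in> orbit (SO_lorentz t) (A2a t x)"
        unfolding av A2a_def using l a by (intro orbit_nonnull [OF n False, of _ l]) auto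
      then show ?thesis by blast
    next
      case neg: False
      with False have "A \<in> orbit (SO_lorentz t) (A2b t x)"
        unfolding av A2b_def using l a by (intro orbit_nonnull [OF n False, of _ l]) auto
      then show ?thesis by blast
    qed
  qed
qed

lemma rank3_canonical:
  fixes t x :: "'n::finite"
  assumes n: "CARD('n) \<ge> 2" "t \<noteq> x" and A: "rank3 t A"
  shows "\<exists>k. k \<noteq> 0 \<and> (A \<in> orbit (SO_lorentz t) (A3a t x k) \<or> A \<in> orbit (SO_lorentz t) (A3b t x k))"
proof -
  obtain a v where av: "A = (a, v)" by fastforce
  have v: "a \<noteq> 0" "mink t v v \<noteq> 0"
    using A by (auto simp: av rank3_def cubic_norm_def mink_sq_mink)
  obtain l where l: "a = exp (2 * l) * sgn a"
    using v(1) by (rule scale_to_unit)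
  \<comment> \<open>The invariant \<open>k\<close> is \<open>a\<^sub>\<mu> a\<^sup>\<mu>\<close> after \<open>a\<close> has been normalised, the square of \<open>((1 + k) / 2, (1 - k) / 2)\<close>.\<close>
  define k where "k = exp (2 * l) * mink t v v"
  have "k = ((1 + k) / 2)\<^sup>2 - ((1 - k) / 2)\<^sup>2"
    by (simp add: power2_eq_square field_simps)
  then have "A \<in> orbit (SO_lorentz t) (elt t x (sgn a) ((1 + k) / 2) ((1 - k) / 2))"
    unfolding av using l by (intro orbit_nonnull [OF n v(2), of _ l]) (simp_all flip: k_def)
  moreover have "k \<noteq> 0" using v(2) by (simp add: k_def)
  ultimately show ?thesis
    using v(1) by (auto simp: A3a_def A3b_def sgn_if split: if_splits intro!: exI [of _ k])
qed

lemma canonical_forms_decompose: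
  fixes t x :: "'n::finite"
  shows "(A1a :: real \<times> (real ^ 'n)) = E1" "(A1b :: real \<times> (real ^ 'n)) = - E1" "A1c t x = E2 t x"
    "A2a t x = E2 t x + E3 t x" "A2c t x = E1 + E2 t x" "A2d t x = - E1 + E2 t x"
    "t \<noteq> x \<Longrightarrow> A2b t x = E2 t x - E3 t x"
    "A3a t x k = E1 + E2 t x + k *\<^sub>R E3 t x" "A3b t x k = - E1 + E2 t x + k *\<^sub>R E3 t x"
  by (auto simp: A1a_def A1b_def A1c_def A2a_def A2b_def A2c_def A2d_def A3a_def A3b_def
      E1_def E2_def E3_def elt_plane vec_eq_iff plane_nth field_simps)

(* The alternatives guarded by CARD('n) = 2 cannot be dropped: in 1+1 dimensions SO(1,1) preserves
   each of the two null lines, so E3 is not related to E2. *)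
theorem theorem1:
  fixes t x :: "'n::finite"
  assumes "CARD('n) \<ge> 2" and "t \<noteq> x"
  shows
    "((A1a :: real \<times> (real ^ 'n)) = E1 \<and> (A1b :: real \<times> (real ^ 'n)) = - E1 \<and> A1c t x = E2 t x \<and>
      A2a t x = E2 t x + E3 t x \<and> A2b t x = E2 t x - E3 t x \<and>
      A2c t x = E1 + E2 t x \<and> A2d t x = - E1 + E2 t x \<and>
      (\<forall>k. A3a t x k = E1 + E2 t x + k *\<^sub>R E3 t x \<and> A3b t x k = - E1 + E2 t x + k *\<^sub>R E3 t x)) \<and>
     (\<forall>A. rank1 t A \<longrightarrow>
        A \<in> orbit (SO_lorentz t) A1a \<or>
        A \<in> orbit (SO_lorentz t) A1b \<or>
        A \<in> orbit (SO_lorentz t) (A1c t x) \<or>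
        CARD('n) = 2 \<and> A \<in> orbit (SO_lorentz t) (E3 t x)) \<and>
     (\<forall>A. rank2 t A \<longrightarrow>
        A \<in> orbit (SO_lorentz t) (A2a t x) \<or>
        A \<in> orbit (SO_lorentz t) (A2b t x) \<or>
        A \<in> orbit (SO_lorentz t) (A2c t x) \<or>
        A \<in> orbit (SO_lorentz t) (A2d t x) \<or>
        CARD('n) = 2 \<and> (A \<in> orbit (SO_lorentz t) (E1 + E3 t x) \<or>
                        A \<in> orbit (SO_lorentz t) (- E1 + E3 t x))) \<and>
     (\<forall>A. rank3 t A \<longrightarrow>
        (\<exists>k. k \<noteq> 0 \<and>
          (A \<in> orbit (SO_lorentz t) (A3a t x k) \<or> A \<in> orbit (SO_lorentz t) (A3b t x k)))) \<and>
     (\<forall>C \<in> {A1c t x, A2c t x, A2d t x}. splits_into t C (future_cone t) (past_cone t)) \<and>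
     splits_into_components t (A2a t x) (future_hyperboloids t) (past_hyperboloids t) \<and>
     (\<forall>k>0. \<forall>C \<in> {A3a t x k, A3b t x k}.
        splits_into_components t C (future_hyperboloids t) (past_hyperboloids t))"
proof -
  note n = assms
  have "splits_into_components t (elt t x c ((1 + k) / 2) ((1 - k) / 2)) (future_hyperboloids t) (past_hyperboloids t)"
    if "k > 0" for k c
  proof (rule timelike_splitting [OF n])
    show "((1 + k) / 2)\<^sup>2 > ((1 - k) / 2)\<^sup>2"
      using that by (simp add: power2_eq_square field_simps)
  qed (use that in simp)
  then have A3: "\<forall>C \<in> {A3a t x k, A3b t x k}.
      splits_into_components t C (future_hyperboloids t) (past_hyperboloids t)" if "k > 0" for k
    using that by (simp add: A3a_def A3b_def)
  have A2a: "splits_into_components t (A2a t x) (future_hyperboloids t) (past_hyperboloids t)"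
    unfolding A2a_def by (intro timelike_splitting n) auto
  have null: "\<forall>C \<in> {A1c t x, A2c t x, A2d t x}. splits_into t C (future_cone t) (past_cone t)"
    using null_splitting [OF n] by (simp add: A1c_def A2c_def A2d_def)
  show ?thesis
    by (intro conjI allI impI canonical_forms_decompose n(2) rank1_canonical [OF n]
        rank2_canonical [OF n] rank3_canonical [OF n] null A2a A3)
qed

end
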